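(* Let $\alpha\ge 1$ and $n\ge\alpha$ be integers, and let $\sigma,\tau\in \mathrm{PB}(\alpha)$. Then in $\mathbb{O}[\alpha;n]=\mathbb{C}[S_n\backslash S_{\alpha+n}/S_n]$ $$\Xi(\sigma)\,\Xi(\tau)=\sum_{\kappa} \mathfrak{c}^\kappa_{\sigma,\tau}(n)\,\Xi(\kappa),$$ where the sum is over all $\kappa\in\mathrm{PB}(\alpha)$ such that $\kappa\sqsupset\sigma\tau$, $\operatorname{dom}\kappa\cap\operatorname{dom}\tau=\operatorname{dom}\sigma\tau$ and $\operatorname{im}\kappa\cap\operatorname{im}\sigma=\operatorname{im}\sigma\tau$, and where $$\mathfrak{c}^\kappa_{\sigma,\tau}(n)=\frac{(n-\alpha+\operatorname{rk}\kappa)!}{(n-2\alpha+\operatorname{rk}\sigma+\operatorname{rk}\tau-\operatorname{rk}\sigma\tau+\operatorname{rk}\kappa)!}=(n-\alpha+\operatorname{rk}\kappa)(n-\alpha+\operatorname{rk}\kappa-1)\cdots(n-2\alpha+\operatorname{rk}\sigma+\operatorname{rk}\tau-\operatorname{rk}\sigma\tau+\operatorname{rk}\kappa+1).$$ Here the product has $\alpha+\operatorname{rk}\sigma\tau-\operatorname{rk}\sigma-\operatorname{rk}\tau\ge 0$ factors (the empty product is $1$), and $1/m!$ is understood as $0$ for integers $m<0$.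
   Context: $\Omega_m=\{1,\dots,m\}$; $S_{\alpha+n}$ is the group of permutations of $\Omega_{\alpha+n}$, and $S_n\subset S_{\alpha+n}$ is the subgroup of permutations fixing each of $1,\dots,\alpha$ (i.e. permuting $\{\alpha+1,\dots,\alpha+n\}$). For a finite group $G$ and subgroup $K$, $\mathbb{C}[K\backslash G/K]$ is the subalgebra of the group algebra $\mathbb{C}[G]$ (convolution product, $\delta_g\delta_h=\delta_{gh}$, where $\delta_g$ is $g$ viewed as an element of $\mathbb{C}[G]$) consisting of elements whose coefficient function is constant on double cosets $KgK$. A partial bijection $\sigma:A\to B$ is a bijection from a subset $\operatorname{dom}\sigma\subset A$ onto a subset $\operatorname{im}\sigma\subset B$; $\operatorname{rk}\sigma=\#\operatorname{dom}\sigma$. The product $\sigma\tau$ is composition of partially defined maps: $\operatorname{dom}\sigma\tau=\{a\in\operatorname{dom}\tau:\tau(a)\in\operatorname{dom}\sigma\}$, $(\sigma\tau)(a)=\sigma(\tau(a))$. $\mathrm{PB}(\alpha)$ is the semigroup of all partial bijections $\Omega_\alpha\to\Omega_\alpha$. Write $\kappa\sqsupset\phi$ ($\kappa$ is an extension of $\phi$) if $\operatorname{dom}\kappa\supset\operatorname{dom}\phi$ and $\kappa$ restricted to $\operatorname{dom}\phi$ equals $\phi$ (in particular $\phi\sqsupset\phi$). For $g\in S_{\alpha+n}$, $[g]_{\alpha\alpha}\in\mathrm{PB}(\alpha)$ is the partial bijection with domain $\{j\le\alpha: g(j)\le\alpha\}$, sending $j$ to $g(j)$ (it corresponds to the upper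 left $\alpha\times\alpha$ corner of the permutation matrix of $g$, whose $(i,j)$ entry is $1$ iff $g(j)=i$). For $\sigma\in\mathrm{PB}(\alpha)$, $$\Xi(\sigma)=\frac1{n!}\sum_{g\in S_{\alpha+n}:\,[g]_{\alpha\alpha}=\sigma}\delta_g .$$ For $n\ge\alpha$ these elements form a basis of $\mathbb{O}[\alpha;n]$. *)

theory Defs
  imports Complex_Main "HOL-Algebra.Sym_Groups" "HOL-Algebra.Module"
begin

section \<open>Group algebras and algebras of double cosets\<close>

text \<open>An element \<open>\<Sum>\<^sub>g f(g) \<delta>\<^sub>g\<close> of the complex group algebra of a finite group \<open>G\<close> is
  represented by its coefficient function \<open>f\<close>, which vanishes outside \<^term>\<open>carrier G\<close>.\<close>

definition delta :: "'g \<Rightarrow> 'g \<Rightarrow> complex" where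
  "delta g = (\<lambda>x. if x = g then 1 else 0)"

definition group_algebra :: "('g, 'b) monoid_scheme \<Rightarrow> (complex, 'g \<Rightarrow> complex) module" where
  "group_algebra G =
    \<lparr> carrier = {f. \<forall>x. x \<notin> carrier G \<longrightarrow> f x = 0},
      mult = (\<lambda>f h x. \<Sum>(a, b)\<in>{(a, b) \<in> carrier G \<times> carrier G. a \<otimes>\<^bsub>G\<^esub> b = x}. f a * h b),
      one = delta \<one>\<^bsub>G\<^esub>,
      zero = (\<lambda>x. 0),
      add = (\<lambda>f h x. f x + h x),
      smult = (\<lambda>c f x. c * f x) \<rparr>"

text \<open>The algebra of double cosets has the operations of the group algebra, but its unit is the
  uniform average over \<open>K\<close>: unless \<open>K\<close> is trivial, \<open>\<delta>\<^sub>1\<close> is not constant on \<open>K\<close>.\<close>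

definition double_coset_algebra ::
  "('g, 'b) monoid_scheme \<Rightarrow> 'g set \<Rightarrow> (complex, 'g \<Rightarrow> complex) module" where
  "double_coset_algebra G K = (group_algebra G)
    \<lparr> carrier := {f \<in> carrier (group_algebra G).
        \<forall>g\<in>carrier G. \<forall>x\<in>(K #>\<^bsub>G\<^esub> g) <#>\<^bsub>G\<^esub> K. f x = f g},
      one := (\<lambda>x. if x \<in> K then 1 / of_nat (card K) else 0) \<rparr>"

section \<open>Partial bijections\<close>

text \<open>A partial bijection is an injective partial map; its domain and image are \<^const>\<open>dom\<close> and
  \<^const>\<open>ran\<close>, the product is \<^const>\<open>map_comp\<close>, and \<open>\<kappa>\<close> extends \<open>\<phi>\<close> iff \<open>\<phi> \<subseteq>\<^sub>m \<kappa>\<close>.\<close>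

definition PB :: "nat \<Rightarrow> (nat \<rightharpoonup> nat) set" where
  "PB \<alpha> = {\<sigma>. dom \<sigma> \<subseteq> {1..\<alpha>} \<and> ran \<sigma> \<subseteq> {1..\<alpha>} \<and> inj_on \<sigma> (dom \<sigma>)}"

definition rk :: "(nat \<rightharpoonup> nat) \<Rightarrow> nat" where
  "rk \<sigma> = card (dom \<sigma>)"

definition corner :: "nat \<Rightarrow> (nat \<Rightarrow> nat) \<Rightarrow> (nat \<rightharpoonup> nat)" where
  "corner \<alpha> g = (\<lambda>j. if j \<in> {1..\<alpha>} \<and> g j \<in> {1..\<alpha>} then Some (g j) else None)"

section \<open>The algebra \<open>\<complex>[S\<^sub>n \ S\<^bsub>\<alpha>+n\<^esub> / S\<^sub>n]\<close> and its basis\<close>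

definition fixing_subgroup :: "nat \<Rightarrow> nat \<Rightarrow> (nat \<Rightarrow> nat) set" where
  "fixing_subgroup \<alpha> n = {g \<in> carrier (sym_group (\<alpha> + n)). \<forall>j\<in>{1..\<alpha>}. g j = j}"

definition Oalg :: "nat \<Rightarrow> nat \<Rightarrow> (complex, (nat \<Rightarrow> nat) \<Rightarrow> complex) module" where
  "Oalg \<alpha> n = double_coset_algebra (sym_group (\<alpha> + n)) (fixing_subgroup \<alpha> n)"

definition Xi :: "nat \<Rightarrow> nat \<Rightarrow> (nat \<rightharpoonup> nat) \<Rightarrow> (nat \<Rightarrow> nat) \<Rightarrow> complex" where
  "Xi \<alpha> n \<sigma> = (1 / fact n) \<odot>\<^bsub>group_algebra (sym_group (\<alpha> + n))\<^esub>
     (\<Oplus>\<^bsub>group_algebra (sym_group (\<alpha> + n))\<^esub>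
        g\<in>{g \<in> carrier (sym_group (\<alpha> + n)). corner \<alpha> g = \<sigma>}. delta g)"

section \<open>Structure constants\<close>

definition inv_fact :: "int \<Rightarrow> complex" where
  "inv_fact m = (if m < 0 then 0 else 1 / fact (nat m))"

text \<open>The argument of \<^const>\<open>inv_fact\<close> may be negative, so it is computed in the integers; the
  subtraction of naturals in the numerator is only meant for \<open>\<alpha> \<le> n\<close>.\<close>

definition struct_const ::
  "nat \<Rightarrow> nat \<Rightarrow> (nat \<rightharpoonup> nat) \<Rightarrow> (nat \<rightharpoonup> nat) \<Rightarrow> (nat \<rightharpoonup> nat) \<Rightarrow> complex" where
  "struct_const \<alpha> n \<sigma> \<tau> \<kappa> = fact (n - \<alpha> + rk \<kappa>) *
     inv_fact (int n - 2 * int \<alpha> + int (rk \<sigma>) + int (rk \<tau>) - int (rk (\<sigma> \<circ>\<^sub>m \<tau>)) + int (rk \<kappa>))"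

section \<open>Consistency of the definitions\<close>

lemma delta_mult:
  assumes "finite (carrier G)" "g \<in> carrier G" "h \<in> carrier G"
  shows "delta g \<otimes>\<^bsub>group_algebra G\<^esub> delta h = delta (g \<otimes>\<^bsub>G\<^esub> h)"
proof
  fix x
  let ?S = "{(a, b) \<in> carrier G \<times> carrier G. a \<otimes>\<^bsub>G\<^esub> b = x}"
  have *: "(\<lambda>(a, b). delta g a * delta h b) = (\<lambda>p. if p = (g, h) then 1 else (0::complex))"
    by (auto simp: delta_def fun_eq_iff)
  have "(\<Sum>(a, b)\<in>?S. delta g a * delta h b) = delta (g \<otimes>\<^bsub>G\<^esub> h) x"
  proof (cases "x = g \<otimes>\<^bsub>G\<^esub> h")
    case True
    have "(\<Sum>p\<in>?S. if p = (g, h) then 1 else (0::complex)) = 1"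
    proof -
      have "finite ?S"
        by (rule finite_subset[of _ "carrier G \<times> carrier G"]) (use assms in auto)
      then show ?thesis using assms True by simp
    qed
    then show ?thesis using True * by (simp add: delta_def)
  next
    case False
    then have "(\<Sum>p\<in>?S. if p = (g, h) then 1 else (0::complex)) = 0"
      by (intro sum.neutral) auto
    then show ?thesis using False * by (simp add: delta_def)
  qed
  then show "(delta g \<otimes>\<^bsub>group_algebra G\<^esub> delta h) x = delta (g \<otimes>\<^bsub>G\<^esub> h) x"
    by (simp add: group_algebra_def)
qed

lemma abelian_group_group_algebra: "abelian_group (group_algebra G)"
proof (rule abelian_groupI)
  fix f assume "f \<in> carrier (group_algebra G)"
  then show "\<exists>h\<in>carrier (group_algebra G). h \<oplus>\<^bsub>group_algebra G\<^esub> f = \<zero>\<^bsub>group_algebra G\<^esub>"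
    by (intro bexI[of _ "\<lambda>x. - f x"]) (auto simp: group_algebra_def)
qed (auto simp: group_algebra_def algebra_simps)

lemma abelian_group_double_coset_algebra: "abelian_group (double_coset_algebra G K)"
proof (rule abelian_groupI)
  fix f assume "f \<in> carrier (double_coset_algebra G K)"
  then show "\<exists>h\<in>carrier (double_coset_algebra G K).
      h \<oplus>\<^bsub>double_coset_algebra G K\<^esub> f = \<zero>\<^bsub>double_coset_algebra G K\<^esub>"
    by (intro bexI[of _ "\<lambda>x. - f x"]) (auto simp: group_algebra_def double_coset_algebra_def)
qed (auto simp: group_algebra_def double_coset_algebra_def algebra_simps)

lemma finsum_group_algebra:
  assumes "finite A" "F \<in> A \<rightarrow> carrier (group_algebra G)"
  shows "(\<Oplus>\<^bsub>group_algebra G\<^esub>a\<in>A. F a) = (\<lambda>x. \<Sum>a\<in>A. F a x)"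
proof -
  interpret abelian_group "group_algebra G" by (rule abelian_group_group_algebra)
  show ?thesis using assms
    by (induction rule: finite_induct) (auto simp: finsum_insert, auto simp: group_algebra_def)
qed

lemma Xi_apply:
  "Xi \<alpha> n \<sigma> g = (if g \<in> carrier (sym_group (\<alpha> + n)) \<and> corner \<alpha> g = \<sigma> then 1 / fact n else 0)"
proof -
  let ?A = "{g \<in> carrier (sym_group (\<alpha> + n)). corner \<alpha> g = \<sigma>}"
  have fin: "finite ?A"
    using finite_permutations[of "{1..\<alpha> + n}"] by (simp add: sym_group_def)
  have "(\<lambda>g. delta g) \<in> ?A \<rightarrow> carrier (group_algebra (sym_group (\<alpha> + n)))"
    by (auto simp: delta_def group_algebra_def)
  then have "Xi \<alpha> n \<sigma> g = (1 / fact n) * (\<Sum>h\<in>?A. if g = h then 1 else 0)"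
    unfolding Xi_def by (subst finsum_group_algebra[OF fin]) (auto simp: group_algebra_def delta_def)
  also have "\<dots> = (if g \<in> ?A then 1 / fact n else 0)"
    using fin by simp
  finally show ?thesis by simp
qed

lemma corner_bi_invariant:
  assumes "g permutes {1..\<alpha> + n}" "k permutes {1..\<alpha> + n}" "l permutes {1..\<alpha> + n}"
    and "\<forall>j\<in>{1..\<alpha>}. k j = j" "\<forall>j\<in>{1..\<alpha>}. l j = j"
  shows "corner \<alpha> (k \<circ> g \<circ> l) = corner \<alpha> g"
proof -
  have "k y \<in> {1..\<alpha>} \<longleftrightarrow> y \<in> {1..\<alpha>}" for y
    using assms(4) permutes_inj[OF assms(2)] by (metis injD)
  then show ?thesis using assms(4,5) by (auto simp: corner_def fun_eq_iff)
qed

lemma Xi_in_Oalg: "Xi \<alpha> n \<sigma> \<in> carrier (Oalg \<alpha> n)"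
proof -
  let ?G = "sym_group (\<alpha> + n)"
  have "Xi \<alpha> n \<sigma> x = Xi \<alpha> n \<sigma> g"
    if g: "g \<in> carrier ?G" and x: "x \<in> (fixing_subgroup \<alpha> n #>\<^bsub>?G\<^esub> g) <#>\<^bsub>?G\<^esub> fixing_subgroup \<alpha> n" for g x
  proof -
    obtain k l where k: "k \<in> fixing_subgroup \<alpha> n" and l: "l \<in> fixing_subgroup \<alpha> n"
      and x: "x = k \<circ> g \<circ> l"
      using x by (auto simp: r_coset_def set_mult_def sym_group_mult)
    have "x \<in> carrier ?G"
      using k l g unfolding x by (auto simp: fixing_subgroup_def sym_group_carrier intro!: permutes_compose)
    moreover have "corner \<alpha> x = corner \<alpha> g"
      unfolding x using k l g
      by (intro corner_bi_invariant[where n = n]) (auto simp: fixing_subgroup_def sym_group_carrier)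
    ultimately show ?thesis using g by (simp add: Xi_apply)
  qed
  moreover have "Xi \<alpha> n \<sigma> \<in> carrier (group_algebra ?G)"
    by (auto simp: group_algebra_def Xi_apply)
  ultimately show ?thesis
    by (auto simp: Oalg_def double_coset_algebra_def)
qed

end

theory Submission
  imports Defs
begin

text \<open>
  The coefficient of a permutation \<open>x\<close> in \<open>\<Xi>(\<sigma>) \<Xi>(\<tau>)\<close> is \<open>1 / n!\<^sup>2\<close> times the number of
  factorizations \<open>x = a b\<close> with corners \<open>\<sigma>\<close> and \<open>\<tau>\<close>. Such a factorization is determined by
  \<open>c = b\<inverse>\<close>, since \<open>a = x c\<close>. The point of this substitution is that both corner conditions then
  restrict only the values of \<open>c\<close> on \<open>V = {1, \<dots>, \<alpha>}\<close>: the values on \<open>im \<tau>\<close> are prescribed by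
  \<open>\<tau>\<inverse>\<close>, those on \<open>dom \<sigma>\<close> are prescribed by \<open>x\<inverse> \<sigma>\<close>, and every other point of \<open>V\<close> must be sent
  outside \<open>V \<union> x\<inverse>(V)\<close>.

  Let \<open>\<kappa>\<close> be the corner of \<open>x\<close>. The two prescriptions agree on \<open>im \<tau> \<inter> dom \<sigma>\<close> iff \<open>\<kappa>\<close> extends
  \<open>\<sigma>\<tau>\<close>. If so, \<open>c\<close> maps no point of \<open>im \<tau> - dom \<sigma>\<close> into \<open>x\<inverse>(V)\<close>, as the corner of \<open>a\<close>
  demands, iff \<open>dom \<kappa> \<inter> dom \<tau> = dom \<sigma>\<tau>\<close>, and no point of \<open>dom \<sigma> - im \<tau>\<close> into \<open>V\<close>, as the corner
  of \<open>b\<close> demands, iff \<open>im \<kappa> \<inter> im \<sigma> = im \<sigma>\<tau>\<close>. So if \<open>\<kappa>\<close> is not of this form, there is no factorization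
  (\<open>corner_comp_in_composites\<close>). If it is, there remain
  \<open>m = \<alpha> + rk \<sigma>\<tau> - rk \<sigma> - rk \<tau>\<close> free points of \<open>V\<close>, to be mapped injectively into a set
  of \<open>M = n - \<alpha> + rk \<kappa>\<close> points, because \<open>V \<inter> x\<inverse>(V)\<close> is the domain of \<open>\<kappa>\<close>. The \<open>n\<close> points
  outside \<open>V\<close> then fill the remaining places in \<open>n!\<close> ways. This gives
  \<open>n! M (M - 1) \<cdots> (M - m + 1)\<close> factorizations (\<open>card_factorizations\<close>), and the falling factorial is
  the structure constant (\<open>struct_const_eq_prod\<close>). One factor \<open>n!\<close> cancels; the other
  normalizes \<open>\<Xi>(\<kappa>)\<close>.
\<close>

section \<open>Counting permutations\<close>

lemma permutation_extending_injection:
  assumes "finite \<Omega>" "D \<subseteq> \<Omega>" "inj_on f D" "f ` D \<subseteq> \<Omega>"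
  obtains q where "q permutes \<Omega>" "\<And>i. i \<in> D \<Longrightarrow> q i = f i"
proof -
  have "card (\<Omega> - D) = card (\<Omega> - f ` D)"
    using assms by (simp add: card_Diff_subset card_image finite_subset)
  then obtain h where h: "bij_betw h (\<Omega> - D) (\<Omega> - f ` D)"
    using assms(1) finite_same_card_bij[of "\<Omega> - D" "\<Omega> - f ` D"] by auto
  define q where "q = (\<lambda>i. if i \<in> D then f i else if i \<in> \<Omega> then h i else i)"
  have "bij_betw q D (f ` D)"
    using assms(3) by (auto simp: bij_betw_def q_def inj_on_def)
  moreover have "bij_betw q (\<Omega> - D) (\<Omega> - f ` D)"
    using h by (rule bij_betw_cong[THEN iffD1, rotated]) (auto simp: q_def)
  ultimately have "bij_betw q (D \<union> (\<Omega> - D)) (f ` D \<union> (\<Omega> - f ` D))"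
    by (rule bij_betw_combine) auto
  then have "bij_betw q \<Omega> \<Omega>"
    using assms(2,4) by (simp add: Un_absorb1)
  then have "q permutes \<Omega>"
    by (rule bij_imp_permutes) (use assms(2) in \<open>auto simp: q_def\<close>)
  then show ?thesis by (rule that) (auto simp: q_def)
qed

text \<open>If \<open>q\<close> is one permutation extending \<open>f\<close>, then \<open>r \<mapsto> q \<circ> r\<close> maps the permutations of \<open>\<Omega> - D\<close>
  bijectively onto all of them.\<close>

lemma card_permutations_extending:
  assumes "finite \<Omega>" "D \<subseteq> \<Omega>" "inj_on f D" "f ` D \<subseteq> \<Omega>"
  shows "card {p. p permutes \<Omega> \<and> (\<forall>i\<in>D. p i = f i)} = fact (card \<Omega> - card D)"
proof -
  obtain q where q: "q permutes \<Omega>" "\<And>i. i \<in> D \<Longrightarrow> q i = f i"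
    using permutation_extending_injection[OF assms] by metis
  have "{p. p permutes \<Omega> \<and> (\<forall>i\<in>D. p i = f i)} = (\<lambda>r. q \<circ> r) ` {r. r permutes (\<Omega> - D)}"
  proof (intro equalityI subsetI)
    fix p assume "p \<in> {p. p permutes \<Omega> \<and> (\<forall>i\<in>D. p i = f i)}"
    then have p: "p permutes \<Omega>" "\<And>i. i \<in> D \<Longrightarrow> p i = f i" by auto
    have "inv' q \<circ> p permutes \<Omega>" using p q by (intro permutes_compose permutes_inv)
    moreover have "(inv' q \<circ> p) i = i" if "i \<in> D" for i
      using p(2)[OF that] q(2)[OF that] permutes_inverses(2)[OF q(1)] by (metis comp_apply)
    ultimately have "inv' q \<circ> p permutes (\<Omega> - D)"
      by (auto intro: permutes_superset)
    moreover have "p = q \<circ> (inv' q \<circ> p)"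
      using permutes_inv_o(1)[OF q(1)] by (simp add: o_assoc)
    ultimately show "p \<in> (\<lambda>r. q \<circ> r) ` {r. r permutes (\<Omega> - D)}" by blast
  next
    fix p assume "p \<in> (\<lambda>r. q \<circ> r) ` {r. r permutes (\<Omega> - D)}"
    then obtain r where r: "r permutes (\<Omega> - D)" "p = q \<circ> r" by auto
    have "r permutes \<Omega>" using r(1) by (rule permutes_subset) auto
    moreover have "r i = i" if "i \<in> D" for i using r(1) that by (auto simp: permutes_def)
    ultimately show "p \<in> {p. p permutes \<Omega> \<and> (\<forall>i\<in>D. p i = f i)}"
      using q r(2) by (auto intro: permutes_compose)
  qed
  moreover have "inj_on (\<lambda>r. q \<circ> r) {r. r permutes (\<Omega> - D)}"
    using permutes_inj[OF q(1)] by (auto simp: inj_on_def fun_eq_iff dest: injD)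
  ultimately show ?thesis
    using assms by (simp add: card_image card_permutations card_Diff_subset finite_subset)
qed

text \<open>The points of \<open>E\<close> are placed one after another; each one uses up one element of \<open>U\<close>. Since
  \<open>int (card U) - int i\<close> vanishes for \<open>i = card U\<close>, the formula also covers sets \<open>E\<close> that are too large
  to fit into \<open>U\<close>, although later factors are then negative.\<close>

lemma card_permutations_extending_into:
  assumes "finite \<Omega>" "finite E" "D \<union> E \<subseteq> \<Omega>" "D \<inter> E = {}"
    and "inj_on f D" "f ` D \<subseteq> \<Omega>" "U \<subseteq> \<Omega> - f ` D"
  shows "int (card {p. p permutes \<Omega> \<and> (\<forall>i\<in>D. p i = f i) \<and> p ` E \<subseteq> U})
    = (\<Prod>i<card E. int (card U) - int i) * fact (card \<Omega> - card D - card E)"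
  using assms(2-)
proof (induction E arbitrary: D f U rule: finite_induct)
  case empty
  then show ?case using card_permutations_extending[OF assms(1)] by simp
next
  case (insert e E)
  have fin: "finite D" "finite U"
    using insert.prems assms(1) by (auto intro: finite_subset)
  let ?S = "{p. p permutes \<Omega> \<and> (\<forall>i\<in>D. p i = f i) \<and> p ` insert e E \<subseteq> U}"
  \<comment> \<open>Once the image \<open>u\<close> of \<open>e\<close> is chosen, \<open>e\<close> is a prescribed point and \<open>u\<close> is no longer free,
    which is an instance of the same problem with \<open>E\<close> in place of \<open>insert e E\<close>.\<close>
  define S where "S u = {p. p permutes \<Omega> \<and> (\<forall>i\<in>insert e D. p i = (f(e := u)) i) \<and> p ` E \<subseteq> U - {u}}"
    for u
  have eD: "e \<notin> D" using insert.prems by auto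
  have S_UN: "?S = (\<Union>u\<in>U. S u)"
  proof (intro equalityI subsetI)
    fix p assume p: "p \<in> ?S"
    then have "p i \<noteq> p e" if "i \<in> E" for i
      using that insert.hyps(2) permutes_inj[of p \<Omega>] by (auto dest: injD)
    then have "p ` E \<subseteq> U - {p e}"
      using p by auto
    then show "p \<in> (\<Union>u\<in>U. S u)" using p eD by (auto simp: S_def)
  next
    fix p assume "p \<in> (\<Union>u\<in>U. S u)"
    then obtain u where "u \<in> U" and p: "p \<in> S u" by blast
    have p: "p permutes \<Omega>" "\<forall>i\<in>insert e D. p i = (f(e := u)) i" "p ` E \<subseteq> U - {u}"
      using p unfolding S_def by blast+
    have "p i = f i" if "i \<in> D" for i
    proof -
      have "i \<noteq> e" using that eD by blast
      then show ?thesis using p(2) that by simp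
    qed
    moreover have "p e = u" using p(2) by simp
    ultimately show "p \<in> ?S" using p(1,3) \<open>u \<in> U\<close> by blast
  qed
  have card_UN: "card (\<Union>u\<in>U. S u) = (\<Sum>u\<in>U. card (S u))"
  proof (rule card_UN_disjoint)
    show "finite U" by (rule fin)
    show "\<forall>u\<in>U. finite (S u)"
      using finite_permutations[OF assms(1)] by (auto simp: S_def)
    show "\<forall>u\<in>U. \<forall>v\<in>U. u \<noteq> v \<longrightarrow> S u \<inter> S v = {}"
    proof (intro ballI impI equals0I)
      fix u v p assume "u \<noteq> v" "p \<in> S u \<inter> S v"
      then have "p e = (f(e := u)) e" "p e = (f(e := v)) e" unfolding S_def by blast+
      then show False using \<open>u \<noteq> v\<close> by simp
    qed
  qed
  have card_S: "int (card (S u)) = (\<Prod>i<card E. int (card U) - int (Suc i)) *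
      fact (card \<Omega> - card D - card (insert e E))" if u: "u \<in> U" for u
  proof -
    have "int (card (S u)) = (\<Prod>i<card E. int (card (U - {u})) - int i) *
        fact (card \<Omega> - card (insert e D) - card E)"
      unfolding S_def
    proof (rule insert.IH)
      have image: "(f(e := u)) ` insert e D = insert u (f ` D)"
        using eD by auto
      have u_notin: "u \<in> \<Omega>" "u \<notin> f ` D" using u insert.prems by blast+
      show "insert e D \<union> E \<subseteq> \<Omega>" "insert e D \<inter> E = {}"
        using insert.prems insert.hyps by blast+
      show "inj_on (f(e := u)) (insert e D)"
        unfolding inj_on_insert
      proof
        show "inj_on (f(e := u)) D"
          using insert.prems(3) u_notin(2) by (rule inj_on_fun_updI)
        show "(f(e := u)) e \<notin> (f(e := u)) ` (D - {e})"
          using u_notin(2) by auto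
      qed
      show "(f(e := u)) ` insert e D \<subseteq> \<Omega>" "U - {u} \<subseteq> \<Omega> - (f(e := u)) ` insert e D"
        unfolding image using insert.prems u_notin by blast+
    qed
    moreover have "int (card (U - {u})) = int (card U) - 1"
      using card_Suc_Diff1[OF fin(2) u] by linarith
    ultimately show ?thesis
      using eD fin insert.hyps by (simp add: algebra_simps)
  qed
  have "int (card ?S) = (\<Sum>u\<in>U. int (card (S u)))"
    by (simp only: S_UN card_UN of_nat_sum)
  also have "\<dots> = int (card U) * ((\<Prod>i<card E. int (card U) - int (Suc i)) *
      fact (card \<Omega> - card D - card (insert e E)))"
    using card_S by simp
  finally have "int (card ?S) = int (card U) * ((\<Prod>i<card E. int (card U) - int (Suc i)) *
      fact (card \<Omega> - card D - card (insert e E)))" .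
  then show ?case
    by (simp only: card_insert_disjoint[OF insert.hyps(1,2)] prod.lessThan_Suc_shift
        of_nat_0 diff_zero mult.assoc)
qed

section \<open>Corners\<close>

text \<open>For large \<open>n\<close> these are exactly the corners of the products \<open>a \<circ> b\<close> of permutations of
  \<open>{1..\<alpha> + n}\<close> with corners \<open>\<sigma>\<close> and \<open>\<tau>\<close>.\<close>

definition composites :: "nat \<Rightarrow> (nat \<rightharpoonup> nat) \<Rightarrow> (nat \<rightharpoonup> nat) \<Rightarrow> (nat \<rightharpoonup> nat) set" where
  "composites \<alpha> \<sigma> \<tau> = {\<kappa> \<in> PB \<alpha>. \<sigma> \<circ>\<^sub>m \<tau> \<subseteq>\<^sub>m \<kappa> \<and>
     dom \<kappa> \<inter> dom \<tau> = dom (\<sigma> \<circ>\<^sub>m \<tau>) \<and> ran \<kappa> \<inter> ran \<sigma> = ran (\<sigma> \<circ>\<^sub>m \<tau>)}"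

lemma PB_inj: "\<sigma> \<in> PB \<alpha> \<Longrightarrow> \<sigma> i = Some j \<Longrightarrow> \<sigma> k = Some j \<Longrightarrow> i = k"
  unfolding PB_def by (metis (mono_tags, lifting) domI inj_onD mem_Collect_eq)

lemma PB_bounds:
  assumes "\<sigma> \<in> PB \<alpha>" "\<sigma> i = Some j"
  shows "i \<in> {1..\<alpha>}" "j \<in> {1..\<alpha>}"
  using assms by (auto simp: PB_def dom_def ran_def)

lemma finite_PB: "finite (PB \<alpha>)"
proof (rule finite_subset)
  show "PB \<alpha> \<subseteq> (\<Union>A\<in>Pow {1..\<alpha>}. {\<sigma>. dom \<sigma> = A \<and> ran \<sigma> \<subseteq> {1..\<alpha>}})"
    by (auto simp: PB_def)
  show "finite (\<Union>A\<in>Pow {1..\<alpha>}. {\<sigma>. dom \<sigma> = A \<and> ran \<sigma> \<subseteq> {1..\<alpha>}})"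
    by (auto intro!: finite_set_of_finite_maps intro: finite_subset)
qed

lemma corner_eq_Some:
  "corner \<alpha> g i = Some j \<longleftrightarrow> i \<in> {1..\<alpha>} \<and> j \<in> {1..\<alpha>} \<and> g i = j"
  by (auto simp: corner_def)

lemma corner_in_PB: "inj g \<Longrightarrow> corner \<alpha> g \<in> PB \<alpha>"
  by (auto simp: PB_def corner_def ran_def inj_on_def dom_def inj_def split: if_splits)

lemma corner_eq_iff:
  assumes "\<sigma> \<in> PB \<alpha>"
  shows "corner \<alpha> g = \<sigma> \<longleftrightarrow> (\<forall>i\<in>{1..\<alpha>}. \<forall>j\<in>{1..\<alpha>}. g i = j \<longleftrightarrow> \<sigma> i = Some j)"
proof
  assume "corner \<alpha> g = \<sigma>"
  then show "\<forall>i\<in>{1..\<alpha>}. \<forall>j\<in>{1..\<alpha>}. g i = j \<longleftrightarrow> \<sigma> i = Some j"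
    by (auto simp: corner_eq_Some)
next
  assume *: "\<forall>i\<in>{1..\<alpha>}. \<forall>j\<in>{1..\<alpha>}. g i = j \<longleftrightarrow> \<sigma> i = Some j"
  have "corner \<alpha> g i = Some j \<longleftrightarrow> \<sigma> i = Some j" for i j
    unfolding corner_eq_Some using * PB_bounds[OF assms] by metis
  then have "corner \<alpha> g i = \<sigma> i" for i
    by (metis not_None_eq)
  then show "corner \<alpha> g = \<sigma>" by (rule ext)
qed

text \<open>A path \<open>k \<mapsto> b k \<mapsto> a (b k)\<close> that starts and ends in \<open>{1..\<alpha>}\<close> contributes to the product of the
  corners iff its midpoint lies in \<open>{1..\<alpha>}\<close> as well. Knowing that \<open>k\<close> is in the domain of the corner of
  \<open>b\<close>, or that \<open>a (b k)\<close> is in the image of the corner of the injective map \<open>a\<close>, forces this.\<close>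

lemma corner_comp_in_composites:
  assumes "inj a" "inj b"
  shows "corner \<alpha> (a \<circ> b) \<in> composites \<alpha> (corner \<alpha> a) (corner \<alpha> b)"
  unfolding composites_def
proof (intro CollectI conjI)
  show "corner \<alpha> (a \<circ> b) \<in> PB \<alpha>"
    using assms by (intro corner_in_PB inj_compose)
  show "corner \<alpha> a \<circ>\<^sub>m corner \<alpha> b \<subseteq>\<^sub>m corner \<alpha> (a \<circ> b)"
    by (auto simp: map_le_def map_comp_def corner_def)
  show "dom (corner \<alpha> (a \<circ> b)) \<inter> dom (corner \<alpha> b) = dom (corner \<alpha> a \<circ>\<^sub>m corner \<alpha> b)"
    by (auto simp: map_comp_def corner_def dom_def split: if_splits option.splits)
  show "ran (corner \<alpha> (a \<circ> b)) \<inter> ran (corner \<alpha> a) = ran (corner \<alpha> a \<circ>\<^sub>m corner \<alpha> b)"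
  proof (intro equalityI subsetI)
    fix j assume "j \<in> ran (corner \<alpha> (a \<circ> b)) \<inter> ran (corner \<alpha> a)"
    then obtain k i where "corner \<alpha> (a \<circ> b) k = Some j" "corner \<alpha> a i = Some j"
      by (auto simp: ran_def)
    then have "k \<in> {1..\<alpha>}" "i \<in> {1..\<alpha>}" "j \<in> {1..\<alpha>}" "b k = i" "a i = j"
      using injD[OF assms(1), of "b k" i] by (auto simp: corner_eq_Some)
    then have "(corner \<alpha> a \<circ>\<^sub>m corner \<alpha> b) k = Some j"
      by (simp add: map_comp_def corner_def)
    then show "j \<in> ran (corner \<alpha> a \<circ>\<^sub>m corner \<alpha> b)" by (auto simp: ran_def)
  qed (auto simp: ran_def map_comp_Some_iff corner_eq_Some)
qed

section \<open>Ranks\<close>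

lemma card_ran_PB:
  assumes "\<tau> \<in> PB \<alpha>"
  shows "card (ran \<tau>) = rk \<tau>"
proof -
  have "inj_on (the \<circ> \<tau>) (dom \<tau>)"
    using PB_inj[OF assms] by (auto simp: inj_on_def dom_def)
  moreover have "ran \<tau> = (the \<circ> \<tau>) ` dom \<tau>" by (force simp: ran_def dom_def image_def)
  ultimately show ?thesis by (simp only: rk_def card_image)
qed

lemma card_ran_inter_dom:
  assumes "\<tau> \<in> PB \<alpha>"
  shows "card (ran \<tau> \<inter> dom \<sigma>) = rk (\<sigma> \<circ>\<^sub>m \<tau>)"
proof -
  have "inj_on (the \<circ> \<tau>) (dom (\<sigma> \<circ>\<^sub>m \<tau>))"
    using PB_inj[OF assms] by (auto simp: inj_on_def dom_def map_comp_Some_iff)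
  moreover have "ran \<tau> \<inter> dom \<sigma> = (the \<circ> \<tau>) ` dom (\<sigma> \<circ>\<^sub>m \<tau>)"
    by (force simp: ran_def dom_def image_def map_comp_Some_iff)
  ultimately show ?thesis by (simp only: rk_def card_image)
qed

lemma PB_finite_dom_ran:
  assumes "\<sigma> \<in> PB \<alpha>"
  shows "finite (dom \<sigma>)" "finite (ran \<sigma>)"
  using assms by (auto simp: PB_def intro: finite_subset)

lemma card_ran_union_dom:
  assumes "\<sigma> \<in> PB \<alpha>" "\<tau> \<in> PB \<alpha>"
  shows "card (ran \<tau> \<union> dom \<sigma>) + rk (\<sigma> \<circ>\<^sub>m \<tau>) = rk \<sigma> + rk \<tau>"
  using card_Un_Int[OF PB_finite_dom_ran(2)[OF assms(2)] PB_finite_dom_ran(1)[OF assms(1)]]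
    card_ran_PB[OF assms(2)] card_ran_inter_dom[OF assms(2), of \<sigma>]
  by (simp add: rk_def)

text \<open>The difference of the two sides counts the points of \<open>{1..\<alpha>}\<close> outside \<open>ran \<tau> \<union> dom \<sigma>\<close>.\<close>

lemma rk_add_le:
  assumes "\<sigma> \<in> PB \<alpha>" "\<tau> \<in> PB \<alpha>"
  shows "rk \<sigma> + rk \<tau> \<le> \<alpha> + rk (\<sigma> \<circ>\<^sub>m \<tau>)"
proof -
  have "card (ran \<tau> \<union> dom \<sigma>) \<le> card {1..\<alpha>}"
    using assms by (intro card_mono) (auto simp: PB_def)
  then show ?thesis using card_ran_union_dom[OF assms] by simp
qed

section \<open>The number of factorizations of a permutation\<close>

lemma card_outside_corner:
  assumes "x permutes {1..\<alpha> + n}" "\<alpha> \<le> n"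
  shows "card {k \<in> {1..\<alpha> + n}. k \<notin> {1..\<alpha>} \<and> x k \<notin> {1..\<alpha>}} = n - \<alpha> + rk (corner \<alpha> x)"
proof -
  let ?V = "{1..\<alpha>}" and ?P = "inv' x ` {1..\<alpha>}"
  have inP: "k \<in> ?P \<longleftrightarrow> x k \<in> ?V" for k
    using permutes_inverses[OF assms(1)] by (metis imageE imageI)
  have "card ?P = \<alpha>"
    using permutes_inj[OF permutes_inv[OF assms(1)]] by (simp add: card_image inj_on_subset)
  moreover have "?V \<inter> ?P = dom (corner \<alpha> x)"
    unfolding set_eq_iff Int_iff inP by (auto simp: corner_def dom_def)
  ultimately have union: "card (?V \<union> ?P) + rk (corner \<alpha> x) = 2 * \<alpha>"
    using card_Un_Int[of ?V ?P] by (simp add: rk_def)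
  have sub: "?V \<union> ?P \<subseteq> {1..\<alpha> + n}"
  proof (intro Un_least subsetI)
    fix k assume "k \<in> ?P"
    then have "x k \<in> {1..\<alpha> + n}" unfolding inP by auto
    then show "k \<in> {1..\<alpha> + n}" by (simp only: permutes_in_image[OF assms(1)])
  qed auto
  have "{k \<in> {1..\<alpha> + n}. k \<notin> ?V \<and> x k \<notin> ?V} = {1..\<alpha> + n} - (?V \<union> ?P)"
    unfolding set_eq_iff Diff_iff Un_iff inP by blast
  then have "card {k \<in> {1..\<alpha> + n}. k \<notin> ?V \<and> x k \<notin> ?V} = \<alpha> + n - card (?V \<union> ?P)"
    using sub card_Diff_subset[OF _ sub] by simp
  then show ?thesis using union assms(2) by simp
qed

text \<open>Here \<open>c\<close> stands for \<open>b\<inverse>\<close> in a factorization \<open>x = a \<circ> b\<close>. The main step translates the two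
  corner conditions into constraints on \<open>c\<close> restricted to \<open>{1..\<alpha>}\<close>: prescribed values \<open>f\<close> on \<open>D\<close>, and
  values in \<open>U\<close> on the rest.\<close>

lemma card_factorizations:
  assumes \<sigma>: "\<sigma> \<in> PB \<alpha>" and \<tau>: "\<tau> \<in> PB \<alpha>" and n: "\<alpha> \<le> n"
    and x: "x permutes {1..\<alpha> + n}" and \<kappa>: "corner \<alpha> x \<in> composites \<alpha> \<sigma> \<tau>"
  shows "int (card {c. c permutes {1..\<alpha> + n} \<and> corner \<alpha> (x \<circ> c) = \<sigma> \<and> corner \<alpha> (inv' c) = \<tau>})
    = (\<Prod>i<\<alpha> + rk (\<sigma> \<circ>\<^sub>m \<tau>) - rk \<sigma> - rk \<tau>. int (n - \<alpha> + rk (corner \<alpha> x)) - int i) * fact n"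
proof -
  let ?V = "{1..\<alpha>}" and ?\<Omega> = "{1..\<alpha> + n}"
  define D where "D = ran \<tau> \<union> dom \<sigma>"
  define f where "f i = (if i \<in> ran \<tau> then (THE j. \<tau> j = Some i) else inv' x (the (\<sigma> i)))" for i
  define U where "U = {k \<in> ?\<Omega>. k \<notin> ?V \<and> x k \<notin> ?V}"
  note PB = PB_bounds[OF \<sigma>] PB_bounds[OF \<tau>]
  \<comment> \<open>On \<open>ran \<tau> \<inter> dom \<sigma>\<close> both corner conditions prescribe a value, and \<open>f\<close> takes the one coming from \<open>\<tau>\<close>.
    That it also satisfies the condition for \<open>\<sigma>\<close> is the hypothesis that the corner of \<open>x\<close> extends
    \<open>\<sigma> \<circ>\<^sub>m \<tau>\<close>.\<close>
  have f_\<tau>: "f i = j" if "\<tau> j = Some i" for i j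
    using that PB_inj[OF \<tau>] by (auto simp: f_def ran_def)
  have f_\<sigma>: "x (f i) = j" if j: "\<sigma> i = Some j" for i j
  proof (cases "i \<in> ran \<tau>")
    case True
    then obtain k where k: "\<tau> k = Some i" by (auto simp: ran_def)
    then have k': "(\<sigma> \<circ>\<^sub>m \<tau>) k = Some j" using j by simp
    then have "corner \<alpha> x k = Some j"
      using \<kappa> unfolding composites_def by (auto simp: map_le_def dom_def)
    then show ?thesis using f_\<tau>[OF k] by (simp add: corner_eq_Some)
  next
    case False
    then show ?thesis using j permutes_inverses(1)[OF x] by (simp add: f_def)
  qed
  \<comment> \<open>The hypotheses on domains and images keep a value prescribed by only one of \<open>\<sigma>\<close>, \<open>\<tau>\<close> from violating
    the negative part of the other corner condition.\<close>
  have x_f_out: "x (f i) \<notin> ?V" if i: "i \<in> ran \<tau>" "\<sigma> i = None" for i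
  proof
    assume V: "x (f i) \<in> ?V"
    obtain j where j: "\<tau> j = Some i" using i by (auto simp: ran_def)
    then have "j \<in> dom (corner \<alpha> x) \<inter> dom \<tau>"
      using V f_\<tau>[OF j] PB(3)[OF j] by (auto simp: corner_def dom_def)
    then have "j \<in> dom (\<sigma> \<circ>\<^sub>m \<tau>)" using \<kappa> by (auto simp: composites_def)
    then show False using i j by (auto simp: map_comp_def)
  qed
  have f_out: "f i \<notin> ?V" if i: "i \<in> dom \<sigma>" "i \<notin> ran \<tau>" for i
  proof
    assume V: "f i \<in> ?V"
    obtain j where j: "\<sigma> i = Some j" using i by auto
    have "corner \<alpha> x (f i) = Some j"
      using V f_\<sigma>[OF j] PB(2)[OF j] by (simp add: corner_eq_Some)
    then have "j \<in> ran (\<sigma> \<circ>\<^sub>m \<tau>)"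
      using \<kappa> j unfolding composites_def by (auto intro: ranI)
    then obtain k l where "\<tau> k = Some l" "\<sigma> l = Some j"
      by (auto simp: ran_def map_comp_Some_iff)
    then show False using PB_inj[OF \<sigma> j] i(2) by (auto simp: ran_def)
  qed
  have f_in: "f i \<in> ?V" if "i \<in> ran \<tau>" for i
    using that f_\<tau> PB(3) by (auto simp: ran_def)
  have x_f_in: "x (f i) \<in> ?V" if "i \<in> dom \<sigma>" for i
    using that f_\<sigma> PB(2) by (auto simp: dom_def)
  have inj: "inj_on f D"
  proof (rule inj_onI)
    fix i k assume ik: "i \<in> D" "k \<in> D" "f i = f k"
    have "i \<in> ran \<tau> \<longleftrightarrow> k \<in> ran \<tau>"
      using ik f_in f_out unfolding D_def by (metis Un_iff)
    moreover have "i \<in> dom \<sigma> \<longleftrightarrow> k \<in> dom \<sigma>"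
      using ik x_f_in x_f_out unfolding D_def by (metis Un_iff domIff)
    ultimately consider "i \<in> ran \<tau>" "k \<in> ran \<tau>" | "i \<in> dom \<sigma>" "k \<in> dom \<sigma>"
      using ik unfolding D_def by blast
    then show "i = k"
    proof cases
      case 1
      then obtain j l where "\<tau> j = Some i" "\<tau> l = Some k" by (auto simp: ran_def)
      then show ?thesis using ik(3) f_\<tau> by (metis option.inject)
    next
      case 2
      then obtain j l where "\<sigma> i = Some j" "\<sigma> k = Some l" by auto
      then show ?thesis using ik(3) f_\<sigma> PB_inj[OF \<sigma>] by metis
    qed
  qed
  have "D \<subseteq> ?V" using \<sigma> \<tau> by (auto simp: D_def PB_def)
  have x_dom: "k \<in> ?\<Omega>" if "x k \<in> ?V" for k
    using that by (subst permutes_in_image[OF x, symmetric]) auto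
  have f_D: "f i \<in> ?\<Omega>" if "i \<in> D" for i
    using that f_in x_f_in x_dom unfolding D_def by (metis UnE atLeastAtMost_iff trans_le_add1)
  have U_D: "f i \<notin> U" if "i \<in> D" for i
    using that f_in x_f_in unfolding D_def U_def by blast
  have constraints: "corner \<alpha> (x \<circ> c) = \<sigma> \<and> corner \<alpha> (inv' c) = \<tau> \<longleftrightarrow>
      (\<forall>i\<in>D. c i = f i) \<and> c ` (?V - D) \<subseteq> U" (is "?L \<longleftrightarrow> ?R")
    if c: "c permutes ?\<Omega>" for c
  proof -
    have inv_c: "inv' c j = i \<longleftrightarrow> c i = j" for i j
      using permutes_inverses[OF c] by metis
    have L: "?L \<longleftrightarrow> (\<forall>i\<in>?V. \<forall>j\<in>?V. (x (c i) = j \<longleftrightarrow> \<sigma> i = Some j) \<and> (c i = j \<longleftrightarrow> \<tau> j = Some i))"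
      unfolding corner_eq_iff[OF \<sigma>] corner_eq_iff[OF \<tau>] comp_apply inv_c by blast
    show ?thesis
    proof
      assume "?L"
      then have L1: "\<And>i j. i \<in> ?V \<Longrightarrow> j \<in> ?V \<Longrightarrow> x (c i) = j \<longleftrightarrow> \<sigma> i = Some j"
        and L2: "\<And>i j. i \<in> ?V \<Longrightarrow> j \<in> ?V \<Longrightarrow> c i = j \<longleftrightarrow> \<tau> j = Some i"
        unfolding L by blast+
      show ?R
      proof (intro conjI ballI subsetI)
        fix i assume "i \<in> D"
        then consider j where "\<tau> j = Some i" | j where "\<sigma> i = Some j"
          by (auto simp: D_def ran_def)
        then show "c i = f i"
        proof cases
          case 1
          then show ?thesis using f_\<tau> L2 PB by blast
        next
          case 2
          then have "x (c i) = x (f i)" using f_\<sigma> L1 PB by metis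
          then show ?thesis using permutes_inj[OF x] by (auto dest: injD)
        qed
      next
        fix k assume "k \<in> c ` (?V - D)"
        then obtain i where i: "i \<in> ?V" "i \<notin> ran \<tau>" "i \<notin> dom \<sigma>" "k = c i"
          unfolding D_def by blast
        have "c i \<in> ?\<Omega>" using i(1) by (subst permutes_in_image[OF c]) auto
        moreover have "c i \<notin> ?V" using L2[OF i(1)] i(2) by (auto simp: ran_def)
        moreover have "x (c i) \<notin> ?V" using L1[OF i(1)] i(3) by (auto simp: dom_def)
        ultimately show "k \<in> U" by (auto simp: U_def i(4))
      qed
    next
      assume R: ?R
      have "(x (c i) = j \<longleftrightarrow> \<sigma> i = Some j) \<and> (c i = j \<longleftrightarrow> \<tau> j = Some i)"
        if ij: "i \<in> ?V" "j \<in> ?V" for i j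
      proof (cases "i \<in> D")
        case True
        then have ci: "c i = f i" using R by blast
        have "x (f i) = j \<longleftrightarrow> \<sigma> i = Some j"
        proof (cases "i \<in> dom \<sigma>")
          case True
          then show ?thesis using f_\<sigma> by auto
        next
          case False
          then have "x (f i) \<notin> ?V" using x_f_out \<open>i \<in> D\<close> by (auto simp: D_def)
          then show ?thesis using False ij by auto
        qed
        moreover have "f i = j \<longleftrightarrow> \<tau> j = Some i"
        proof (cases "i \<in> ran \<tau>")
          case True
          then show ?thesis using f_\<tau> by (auto simp: ran_def)
        next
          case False
          then have "f i \<notin> ?V" using f_out \<open>i \<in> D\<close> by (auto simp: D_def)
          then show ?thesis using False ij by (auto simp: ran_def)
        qed
        ultimately show ?thesis using ci by simp
      next
        case False
        then have "c i \<in> U" using R ij(1) by blast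
        then have "c i \<notin> ?V" "x (c i) \<notin> ?V" unfolding U_def by blast+
        moreover have "\<sigma> i \<noteq> Some j" "\<tau> j \<noteq> Some i"
          using False by (auto simp: D_def ran_def dom_def)
        ultimately show ?thesis using ij by auto
      qed
      then show ?L unfolding L by blast
    qed
  qed
  have set_eq: "{c. c permutes ?\<Omega> \<and> corner \<alpha> (x \<circ> c) = \<sigma> \<and> corner \<alpha> (inv' c) = \<tau>} =
      {c. c permutes ?\<Omega> \<and> (\<forall>i\<in>D. c i = f i) \<and> c ` (?V - D) \<subseteq> U}"
    using constraints by blast
  have count: "int (card {c. c permutes ?\<Omega> \<and> (\<forall>i\<in>D. c i = f i) \<and> c ` (?V - D) \<subseteq> U}) =
      (\<Prod>i<card (?V - D). int (card U) - int i) * fact (card ?\<Omega> - card D - card (?V - D))"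
  proof (rule card_permutations_extending_into)
    show "D \<union> (?V - D) \<subseteq> ?\<Omega>" using \<open>D \<subseteq> ?V\<close> by auto
    show "f ` D \<subseteq> ?\<Omega>" using f_D by blast
    show "U \<subseteq> ?\<Omega> - f ` D" using U_D by (auto simp: U_def)
  qed (use inj in auto)
  have card_U: "card U = n - \<alpha> + rk (corner \<alpha> x)"
    unfolding U_def by (rule card_outside_corner[OF x n])
  have card_D: "card D + rk (\<sigma> \<circ>\<^sub>m \<tau>) = rk \<sigma> + rk \<tau>"
    unfolding D_def by (rule card_ran_union_dom[OF \<sigma> \<tau>])
  have "card D \<le> \<alpha>"
    using card_mono[OF _ \<open>D \<subseteq> ?V\<close>] by simp
  moreover have "card (?V - D) = \<alpha> - card D"
    using card_Diff_subset[OF finite_subset[OF \<open>D \<subseteq> ?V\<close>] \<open>D \<subseteq> ?V\<close>] by simp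
  ultimately have card_E: "card (?V - D) = \<alpha> + rk (\<sigma> \<circ>\<^sub>m \<tau>) - rk \<sigma> - rk \<tau>"
    and "card ?\<Omega> - card D - card (?V - D) = n"
    using card_D by simp_all
  then show ?thesis by (simp only: set_eq count card_U)
qed

section \<open>Structure constants and products\<close>

text \<open>Because \<open>1 / m!\<close> is read as \<open>0\<close> for \<open>m < 0\<close>, the recursion \<open>1 / (k - 1)! = k / k!\<close> holds for all
  integers, so the structure constants can be treated without distinguishing whether they vanish.\<close>

lemma inv_fact_pred: "inv_fact (k - 1) = of_int k * inv_fact k"
proof (cases "k \<le> 0")
  case False
  then have "nat k = Suc (nat (k - 1))" by simp
  moreover from this have "of_int k = (of_nat (Suc (nat (k - 1))) :: complex)"
    using False by (metis int_nat_eq nle_le of_int_of_nat_eq)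
  ultimately show ?thesis using False
    by (simp add: inv_fact_def fact_Suc del: of_nat_Suc)
qed (auto simp: inv_fact_def)

lemma falling_factorial_eq_fact_ratio:
  "fact M * inv_fact (int M - int m) = (\<Prod>i<m. of_int (int M - int i))"
proof (induction m)
  case 0
  then show ?case by (simp add: inv_fact_def)
next
  case (Suc m)
  have "int M - int (Suc m) = (int M - int m) - 1" by simp
  then have "fact M * inv_fact (int M - int (Suc m)) =
      (fact M * inv_fact (int M - int m)) * of_int (int M - int m)"
    by (simp only: inv_fact_pred mult_ac)
  then show ?case by (simp only: Suc.IH prod.lessThan_Suc)
qed

lemma struct_const_eq_prod:
  assumes "\<alpha> \<le> n" "\<sigma> \<in> PB \<alpha>" "\<tau> \<in> PB \<alpha>"
  shows "struct_const \<alpha> n \<sigma> \<tau> \<kappa> = (\<Prod>i<\<alpha> + rk (\<sigma> \<circ>\<^sub>m \<tau>) - rk \<sigma> - rk \<tau>.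
      of_int (int n - int \<alpha> + int (rk \<kappa>) - int i))"
proof -
  let ?M = "n - \<alpha> + rk \<kappa>" and ?m = "\<alpha> + rk (\<sigma> \<circ>\<^sub>m \<tau>) - rk \<sigma> - rk \<tau>"
  have M: "int ?M = int n - int \<alpha> + int (rk \<kappa>)" using assms(1) by simp
  have "int n - 2 * int \<alpha> + int (rk \<sigma>) + int (rk \<tau>) - int (rk (\<sigma> \<circ>\<^sub>m \<tau>)) + int (rk \<kappa>) =
      int ?M - int ?m"
    using rk_add_le[OF assms(2,3)] assms(1) by linarith
  then show ?thesis
    unfolding struct_const_def using falling_factorial_eq_fact_ratio[of ?M ?m] by (simp only: M)
qed

lemma Xi_mult_apply:
  assumes x: "x permutes {1..\<alpha> + n}"
  shows "(Xi \<alpha> n \<sigma> \<otimes>\<^bsub>Oalg \<alpha> n\<^esub> Xi \<alpha> n \<tau>) x = of_nat (card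
    {c. c permutes {1..\<alpha> + n} \<and> corner \<alpha> (x \<circ> c) = \<sigma> \<and> corner \<alpha> (inv' c) = \<tau>}) / (fact n * fact n)"
proof -
  let ?\<Omega> = "{1..\<alpha> + n}"
  let ?S = "{(a, b). a permutes ?\<Omega> \<and> b permutes ?\<Omega> \<and> a \<circ> b = x}"
  let ?C = "{c. c permutes ?\<Omega> \<and> corner \<alpha> (x \<circ> c) = \<sigma> \<and> corner \<alpha> (inv' c) = \<tau>}"
  have S: "?S = {(a, b) \<in> carrier (sym_group (\<alpha> + n)) \<times> carrier (sym_group (\<alpha> + n)).
      a \<otimes>\<^bsub>sym_group (\<alpha> + n)\<^esub> b = x}"
    by (auto simp: sym_group_carrier sym_group_mult)
  have "bij_betw (\<lambda>c. (x \<circ> c, inv' c)) {c. c permutes ?\<Omega>} ?S"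
  proof (rule bij_betwI[where g = "\<lambda>(a, b). inv' b"])
    show "(\<lambda>c. (x \<circ> c, inv' c)) \<in> {c. c permutes ?\<Omega>} \<rightarrow> ?S"
      using x by (auto intro: permutes_compose permutes_inv simp: comp_assoc permutes_inv_o)
    show "(\<lambda>(a, b). inv' b) \<in> ?S \<rightarrow> {c. c permutes ?\<Omega>}"
      by (auto intro: permutes_inv)
    show "(case (x \<circ> c, inv' c) of (a, b) \<Rightarrow> inv' b) = c" if "c \<in> {c. c permutes ?\<Omega>}" for c
      using that by (auto simp: permutes_inv_inv)
    show "(x \<circ> (case p of (a, b) \<Rightarrow> inv' b), inv' (case p of (a, b) \<Rightarrow> inv' b)) = p" if "p \<in> ?S" for p
      using that by (auto simp: comp_assoc permutes_inv_o permutes_inv_inv)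
  qed
  then have "(\<Sum>(a, b)\<in>?S. Xi \<alpha> n \<sigma> a * Xi \<alpha> n \<tau> b) =
      (\<Sum>c | c permutes ?\<Omega>. Xi \<alpha> n \<sigma> (x \<circ> c) * Xi \<alpha> n \<tau> (inv' c))"
    by (subst sum.reindex_bij_betw[symmetric]) auto
  also have "\<dots> = (\<Sum>c | c permutes ?\<Omega>. if c \<in> ?C then 1 / (fact n * fact n) else 0)"
    using x by (intro sum.cong)
      (auto simp: Xi_apply sym_group_carrier permutes_compose permutes_inv)
  also have "\<dots> = (\<Sum>c\<in>?C. 1 / (fact n * fact n))"
    using finite_permutations[of ?\<Omega>] by (intro sum.mono_neutral_cong_right) auto
  finally show ?thesis
    unfolding S by (simp add: Oalg_def double_coset_algebra_def group_algebra_def)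
qed

lemma finsum_double_coset_algebra:
  assumes "finite A" "F \<in> A \<rightarrow> carrier (double_coset_algebra G K)"
  shows "(\<Oplus>\<^bsub>double_coset_algebra G K\<^esub>a\<in>A. F a) = (\<lambda>x. \<Sum>a\<in>A. F a x)"
proof -
  interpret abelian_group "double_coset_algebra G K"
    by (rule abelian_group_double_coset_algebra)
  show ?thesis using assms
    by (induction rule: finite_induct)
      (auto simp: finsum_insert, auto simp: double_coset_algebra_def group_algebra_def)
qed

lemma Oalg_smult: "c \<odot>\<^bsub>Oalg \<alpha> n\<^esub> f = (\<lambda>x. c * f x)"
  by (simp add: Oalg_def double_coset_algebra_def group_algebra_def)

lemma Oalg_smult_closed:
  "f \<in> carrier (Oalg \<alpha> n) \<Longrightarrow> c \<odot>\<^bsub>Oalg \<alpha> n\<^esub> f \<in> carrier (Oalg \<alpha> n)"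
  by (auto simp: Oalg_def double_coset_algebra_def group_algebra_def)

lemma Xi_mult:
  assumes n: "\<alpha> \<le> n" and \<sigma>: "\<sigma> \<in> PB \<alpha>" and \<tau>: "\<tau> \<in> PB \<alpha>"
  shows "Xi \<alpha> n \<sigma> \<otimes>\<^bsub>Oalg \<alpha> n\<^esub> Xi \<alpha> n \<tau> =
    (\<Oplus>\<^bsub>Oalg \<alpha> n\<^esub> \<kappa>\<in>composites \<alpha> \<sigma> \<tau>. struct_const \<alpha> n \<sigma> \<tau> \<kappa> \<odot>\<^bsub>Oalg \<alpha> n\<^esub> Xi \<alpha> n \<kappa>)"
proof
  fix x
  have fin: "finite (composites \<alpha> \<sigma> \<tau>)"
    using finite_PB by (rule finite_subset[rotated]) (auto simp: composites_def)
  have "(\<Oplus>\<^bsub>Oalg \<alpha> n\<^esub> \<kappa>\<in>composites \<alpha> \<sigma> \<tau>. struct_const \<alpha> n \<sigma> \<tau> \<kappa> \<odot>\<^bsub>Oalg \<alpha> n\<^esub> Xi \<alpha> n \<kappa>) x =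
      (\<Sum>\<kappa>\<in>composites \<alpha> \<sigma> \<tau>. (struct_const \<alpha> n \<sigma> \<tau> \<kappa> \<odot>\<^bsub>Oalg \<alpha> n\<^esub> Xi \<alpha> n \<kappa>) x)"
    using finsum_double_coset_algebra[OF fin, where G = "sym_group (\<alpha> + n)"
        and K = "fixing_subgroup \<alpha> n"] Oalg_smult_closed[OF Xi_in_Oalg]
    unfolding Oalg_def by (simp add: Pi_def)
  also have "\<dots> = (\<Sum>\<kappa>\<in>composites \<alpha> \<sigma> \<tau>.
      if \<kappa> = corner \<alpha> x then (if x permutes {1..\<alpha> + n} then struct_const \<alpha> n \<sigma> \<tau> \<kappa> / fact n else 0) else 0)"
    by (intro sum.cong) (auto simp: Oalg_smult Xi_apply sym_group_carrier)
  finally have rhs: "(\<Oplus>\<^bsub>Oalg \<alpha> n\<^esub> \<kappa>\<in>composites \<alpha> \<sigma> \<tau>.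
      struct_const \<alpha> n \<sigma> \<tau> \<kappa> \<odot>\<^bsub>Oalg \<alpha> n\<^esub> Xi \<alpha> n \<kappa>) x =
      (if corner \<alpha> x \<in> composites \<alpha> \<sigma> \<tau> \<and> x permutes {1..\<alpha> + n}
       then struct_const \<alpha> n \<sigma> \<tau> (corner \<alpha> x) / fact n else 0)"
    using fin by simp
  show "(Xi \<alpha> n \<sigma> \<otimes>\<^bsub>Oalg \<alpha> n\<^esub> Xi \<alpha> n \<tau>) x =
    (\<Oplus>\<^bsub>Oalg \<alpha> n\<^esub> \<kappa>\<in>composites \<alpha> \<sigma> \<tau>. struct_const \<alpha> n \<sigma> \<tau> \<kappa> \<odot>\<^bsub>Oalg \<alpha> n\<^esub> Xi \<alpha> n \<kappa>) x"
  proof (cases "x permutes {1..\<alpha> + n}")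
    case x: True
    let ?C = "{c. c permutes {1..\<alpha> + n} \<and> corner \<alpha> (x \<circ> c) = \<sigma> \<and> corner \<alpha> (inv' c) = \<tau>}"
    show ?thesis
    proof (cases "corner \<alpha> x \<in> composites \<alpha> \<sigma> \<tau>")
      case True
      have "(of_nat (card ?C) :: complex) = of_int (int (card ?C))" by simp
      also have "\<dots> = struct_const \<alpha> n \<sigma> \<tau> (corner \<alpha> x) * fact n"
        unfolding card_factorizations[OF \<sigma> \<tau> n x True] struct_const_eq_prod[OF n \<sigma> \<tau>]
        using n by (simp add: algebra_simps)
      finally show ?thesis using x True by (simp add: rhs Xi_mult_apply)
    next
      case False
      have "?C = {}"
      proof (intro equals0I)
        fix c assume c: "c \<in> ?C"
        then have "x \<circ> c permutes {1..\<alpha> + n}" "inv' c permutes {1..\<alpha> + n}"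
          using x by (auto intro: permutes_compose permutes_inv)
        then have "corner \<alpha> (x \<circ> c \<circ> inv' c) \<in> composites \<alpha> \<sigma> \<tau>"
          using corner_comp_in_composites[of "x \<circ> c" "inv' c" \<alpha>] c permutes_inj by auto
        moreover have "x \<circ> c \<circ> inv' c = x"
          using c by (auto simp: comp_assoc permutes_inv_o)
        ultimately show False using False by simp
      qed
      then show ?thesis using x False by (simp only: rhs Xi_mult_apply) simp
    qed
  next
    case False
    have no_pairs: "{(a, b) \<in> carrier (sym_group (\<alpha> + n)) \<times> carrier (sym_group (\<alpha> + n)).
        a \<otimes>\<^bsub>sym_group (\<alpha> + n)\<^esub> b = x} = {}" (is "?S = {}")
      using False by (auto simp: sym_group_carrier sym_group_mult intro: permutes_compose)
    have "(Xi \<alpha> n \<sigma> \<otimes>\<^bsub>Oalg \<alpha> n\<^esub> Xi \<alpha> n \<tau>) x = (\<Sum>(a, b)\<in>?S. Xi \<alpha> n \<sigma> a * Xi \<alpha> n \<tau> b)"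
      by (simp add: Oalg_def double_coset_algebra_def group_algebra_def)
    then show ?thesis
      using False unfolding rhs no_pairs by simp
  qed
qed

theorem theorem2p4:
  fixes \<alpha> n :: nat and \<sigma> \<tau> :: "nat \<rightharpoonup> nat"
  assumes "\<alpha> \<ge> 1" and "n \<ge> \<alpha>" and "\<sigma> \<in> PB \<alpha>" and "\<tau> \<in> PB \<alpha>"
  shows "Xi \<alpha> n \<sigma> \<otimes>\<^bsub>Oalg \<alpha> n\<^esub> Xi \<alpha> n \<tau> =
           (\<Oplus>\<^bsub>Oalg \<alpha> n\<^esub> \<kappa>\<in>{\<kappa> \<in> PB \<alpha>. \<sigma> \<circ>\<^sub>m \<tau> \<subseteq>\<^sub>m \<kappa> \<and>
                dom \<kappa> \<inter> dom \<tau> = dom (\<sigma> \<circ>\<^sub>m \<tau>) \<and> ran \<kappa> \<inter> ran \<sigma> = ran (\<sigma> \<circ>\<^sub>m \<tau>)}.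
              struct_const \<alpha> n \<sigma> \<tau> \<kappa> \<odot>\<^bsub>Oalg \<alpha> n\<^esub> Xi \<alpha> n \<kappa>) \<and>
         rk \<sigma> + rk \<tau> \<le> \<alpha> + rk (\<sigma> \<circ>\<^sub>m \<tau>) \<and>
         (\<forall>\<kappa>\<in>{\<kappa> \<in> PB \<alpha>. \<sigma> \<circ>\<^sub>m \<tau> \<subseteq>\<^sub>m \<kappa> \<and>
                dom \<kappa> \<inter> dom \<tau> = dom (\<sigma> \<circ>\<^sub>m \<tau>) \<and> ran \<kappa> \<inter> ran \<sigma> = ran (\<sigma> \<circ>\<^sub>m \<tau>)}.
            struct_const \<alpha> n \<sigma> \<tau> \<kappa> =
              (\<Prod>i<\<alpha> + rk (\<sigma> \<circ>\<^sub>m \<tau>) - rk \<sigma> - rk \<tau>.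
                 of_int (int n - int \<alpha> + int (rk \<kappa>) - int i)))"
  unfolding composites_def[symmetric]
  by (intro conjI ballI Xi_mult[OF assms(2-4)] rk_add_le[OF assms(3,4)] struct_const_eq_prod[OF assms(2-4)])

end
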